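(* Suppose $\{g_n\}$ is an increasing sequence of non-negative extended real valued Lebesgue measurable functions on $[0,1]$ and $f$ is a non-negative extended real valued function on $[0,1]$. If $\lim_{n\to\infty}g_n(x)=f(x)$ for almost all $x$, then $$\int f\,d\mu=\lim_{n\to\infty}\int g_n\,d\mu .$$ In particular $f$ is integrable if and only if $\lim_{n\to\infty}\int g_n\,d\mu<+\infty$.
   Context: $\mu$ is Lebesgue measure on $[0,1]$; "for almost all $x$" means for all $x$ outside a set of Lebesgue measure zero. For a bounded measurable function $h$, $\int h\,d\mu$ is its Lebesgue integral. For a non-negative (extended real valued) measurable function $f$, $\int f\,d\mu=\lim_{n\to\infty}\int\min\{f,n\}\,d\mu\in[0,+\infty]$, and $f$ is called integrable if $\int f\,d\mu<\infty$. *)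

theory Defs
  imports "HOL-Analysis.Analysis"
begin

abbreviation mu :: "real measure" where
  "mu \<equiv> lebesgue_on {0..1}"

text \<open>
  The truncation \<open>min f n\<close> is finite, so \<open>enn2real\<close> loses nothing in the inner
  integral, which is the Bochner integral of a bounded real function.
  Only the values of \<open>f\<close> on the unit interval matter.
\<close>

definition lebesgue_int :: "(real \<Rightarrow> ennreal) \<Rightarrow> ennreal" where
  "lebesgue_int f = lim (\<lambda>n. ennreal (\<integral>x. enn2real (min (f x) (of_nat n)) \<partial>mu))"

definition lebesgue_integrable :: "(real \<Rightarrow> ennreal) \<Rightarrow> bool" where
  "lebesgue_integrable f \<longleftrightarrow> f \<in> borel_measurable mu \<and> lebesgue_int f < \<infinity>"

lemma truncations_tendsto_nn_integral:
  assumes [measurable]: "f \<in> borel_measurable mu"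
  shows "(\<lambda>n. ennreal (\<integral>x. enn2real (min (f x) (of_nat n)) \<partial>mu)) \<longlonglongrightarrow> (\<integral>\<^sup>+x. f x \<partial>mu)"
proof -
  interpret finite_measure mu
    by (rule finite_measure_lebesgue_on) simp
  have fin: "min (f x) (of_nat n) < top" for x n
    by (simp add: min_less_iff_disj of_nat_less_top)
  have bound: "enn2real (min (f x) (of_nat n)) \<le> real n" for x n
    by (rule enn2real_leI) (auto simp: ennreal_of_nat_eq_real_of_nat)
  have int: "integrable mu (\<lambda>x. enn2real (min (f x) (of_nat n)))" for n
    by (rule integrable_const_bound[where B = "real n"]) (auto simp: bound)
  have eq: "ennreal (\<integral>x. enn2real (min (f x) (of_nat n)) \<partial>mu)
      = (\<integral>\<^sup>+x. min (f x) (of_nat n) \<partial>mu)" for n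
    using nn_integral_eq_integral[OF int, of n] fin by simp
  have inc: "incseq (\<lambda>n x. min (f x) (of_nat n :: ennreal))"
    by (auto simp: incseq_def le_fun_def intro!: min.coboundedI2 of_nat_mono)
  have lim: "(\<lambda>n. min (f x) (of_nat n :: ennreal)) \<longlonglongrightarrow> f x" for x
  proof -
    have "(\<lambda>n. min (f x) (of_nat n :: ennreal)) \<longlonglongrightarrow> min (f x) top"
      by (intro tendsto_min tendsto_const of_nat_tendsto_top_ennreal)
    then show ?thesis by simp
  qed
  have sup: "(SUP n. min (f x) (of_nat n :: ennreal)) = f x" for x
    using LIMSEQ_unique[OF LIMSEQ_SUP lim] inc by (auto simp: incseq_def le_fun_def)
  have "(\<integral>\<^sup>+x. f x \<partial>mu) = (SUP n. \<integral>\<^sup>+x. min (f x) (of_nat n) \<partial>mu)"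
    using nn_integral_monotone_convergence_SUP[OF inc, of mu] by (simp add: sup)
  moreover have "incseq (\<lambda>n. \<integral>\<^sup>+x. min (f x) (of_nat n) \<partial>mu)"
    using inc by (auto simp: incseq_def le_fun_def intro!: nn_integral_mono)
  ultimately show ?thesis
    unfolding eq by (simp add: LIMSEQ_SUP)
qed

lemma lebesgue_int_eq_nn_integral:
  "f \<in> borel_measurable mu \<Longrightarrow> lebesgue_int f = (\<integral>\<^sup>+x. f x \<partial>mu)"
  unfolding lebesgue_int_def by (rule limI) (rule truncations_tendsto_nn_integral)

end

theory Submission imports Defs begin

text \<open>
  This is the monotone convergence theorem on the unit interval. The supremum \<open>s = (SUP n. g n)\<close>
  is measurable as a countable supremum, and it equals \<open>f\<close> almost everywhere, because a monotone
  sequence of extended reals converges to its supremum. Lebesgue measure on an interval is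
  complete, so a function that agrees almost everywhere with a measurable one is itself measurable
  (\<open>borel_measurable_cong_AE_complete\<close>, \<open>complete_measure_lebesgue_on\<close>); this is where the
  measurability of \<open>f\<close> comes from. The integrals \<open>\<integral>g n\<close> increase to \<open>\<integral>s = \<integral>f\<close> by monotone
  convergence for the non-negative integral, which for measurable functions agrees with the
  truncation integral. Integrability of \<open>f\<close> then merely says that this limit is finite.
\<close>

text \<open>
  A null set contained in \<open>S\<close> is a null set of the whole line, so completeness is inherited from
  Lebesgue measure, which is a completion by construction.
\<close>

lemma complete_measure_lebesgue_on:
  assumes "S \<in> sets lebesgue"
  shows "complete_measure (lebesgue_on S)"
proof
  fix A B :: "'a set"
  assume "B \<subseteq> A" and "A \<in> null_sets (lebesgue_on S)"
  with assms have "A \<subseteq> S" and "A \<in> null_sets lebesgue"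
    by (auto simp: null_sets_restrict_space)
  with \<open>B \<subseteq> A\<close> have "B \<in> null_sets lebesgue"
    using null_sets_completion_subset by blast
  with \<open>B \<subseteq> A\<close> \<open>A \<subseteq> S\<close> assms show "B \<in> sets (lebesgue_on S)"
    by (auto simp: sets_restrict_space_iff)
qed

text \<open>
  The preimages of a set under the two functions differ only within the exceptional set, and
  completeness makes any set that is almost everywhere equal to a measurable one measurable.
\<close>

lemma (in complete_measure) borel_measurable_cong_AE_complete:
  fixes f h :: "'a \<Rightarrow> 'b::topological_space"
  assumes h: "h \<in> borel_measurable M" and eq: "AE x in M. h x = f x"
  shows "f \<in> borel_measurable M"
proof (rule measurableI)
  fix B :: "'b set"
  assume B: "B \<in> sets borel"
  show "f -` B \<inter> space M \<in> sets M"
  proof (rule in_sets_AE)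
    show "h -` B \<inter> space M \<in> sets M"
      using h B by (rule measurable_sets)
    show "AE x in M. (x \<in> h -` B \<inter> space M) = (x \<in> f -` B \<inter> space M)"
      using eq by (rule AE_mp) auto
  qed auto
qed simp

theorem theorem4p2p2:
  fixes g :: "nat \<Rightarrow> real \<Rightarrow> ennreal" and f :: "real \<Rightarrow> ennreal"
  assumes "\<And>n. g n \<in> borel_measurable mu"
    and "\<And>x. x \<in> {0..1} \<Longrightarrow> incseq (\<lambda>n. g n x)"
    and "AE x in mu. (\<lambda>n. g n x) \<longlonglongrightarrow> f x"
  shows "f \<in> borel_measurable mu
    \<and> (\<lambda>n. lebesgue_int (g n)) \<longlonglongrightarrow> lebesgue_int f
    \<and> (lebesgue_integrable f \<longleftrightarrow> lim (\<lambda>n. lebesgue_int (g n)) < \<infinity>)"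
proof -
  have inc: "g n x \<le> g m x" if "n \<le> m" and "x \<in> space mu" for n m x
    using incseqD[OF assms(2)] that by simp
  have sup: "AE x in mu. (SUP n. g n x) = f x"
    using assms(3)
  proof (rule AE_mp, intro AE_I2 impI)
    fix x assume "x \<in> space mu" and "(\<lambda>n. g n x) \<longlonglongrightarrow> f x"
    then show "(SUP n. g n x) = f x"
      using LIMSEQ_unique[OF LIMSEQ_SUP[OF assms(2)]] by simp
  qed
  have f: "f \<in> borel_measurable mu"
  proof (rule complete_measure.borel_measurable_cong_AE_complete[OF _ _ sup])
    show "complete_measure mu"
      by (rule complete_measure_lebesgue_on) simp
    show "(\<lambda>x. SUP n. g n x) \<in> borel_measurable mu"
      using assms(1) by simp
  qed
  have "(\<integral>\<^sup>+x. f x \<partial>mu) = (\<integral>\<^sup>+x. (SUP n. g n x) \<partial>mu)"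
    using sup by (intro nn_integral_cong_AE) auto
  also have "\<dots> = (SUP n. \<integral>\<^sup>+x. g n x \<partial>mu)"
    using assms(1) inc by (intro nn_integral_monotone_convergence_SUP_AE) auto
  finally have int_f: "(\<integral>\<^sup>+x. f x \<partial>mu) = (SUP n. \<integral>\<^sup>+x. g n x \<partial>mu)" .
  have "incseq (\<lambda>n. \<integral>\<^sup>+x. g n x \<partial>mu)"
    using inc by (intro incseq_SucI nn_integral_mono) simp
  then have lim: "(\<lambda>n. lebesgue_int (g n)) \<longlonglongrightarrow> lebesgue_int f"
    using LIMSEQ_SUP by (simp add: lebesgue_int_eq_nn_integral f assms(1) int_f)
  then have "lebesgue_integrable f \<longleftrightarrow> lim (\<lambda>n. lebesgue_int (g n)) < \<infinity>"
    using f by (simp add: lebesgue_integrable_def limI)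
  with f lim show ?thesis
    by blast
qed

end
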